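(* For $n\ge 0$ let $\mathcal{B}_n(x)=\sum_{j=0}^n S(n,j)x^j$ be the $n$-th Bell polynomial, where $S(n,j)$ are the Stirling numbers of the second kind. For $n\ge 2$ and $1\le m\le n-1$ let $\zeta_m(n)$ denote the $m$-th negative zero of $\mathcal{B}_n$, the negative zeros being ordered in decreasing size (so $\zeta_1(n)$ is the negative zero closest to $0$). Then for every positive integer $m$, $$\lim_{n\to\infty}\frac{\zeta_m(n)}{-m\left(\frac{m}{m+1}\right)^{n-1}}=1.$$
   Context: The Stirling numbers of the second kind are $S(n,j)=\sum_{i=0}^j\frac{(-1)^{j-i}i^n}{(j-i)!\,i!}$ for $0\le j\le n$, equivalently defined by $x^n=\sum_{j=0}^n S(n,j)\,x(x-1)\cdots(x-j+1)$. For $n\ge1$ the Bell polynomial $\mathcal{B}_n$ has a simple zero at $0$ and $n-1$ simple negative zeros (all zeros real). *)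

theory Defs
  imports "HOL-Analysis.Analysis" "HOL-Combinatorics.Stirling"
begin

text \<open>The library introduces the Stirling numbers of the second kind by their recurrence; this is
  the explicit formula for them.\<close>

lemma Stirling_explicit:
  "real (Stirling n j) = (\<Sum>i\<le>j. (-1) ^ (j - i) * real i ^ n / (fact (j - i) * fact i))"
proof (induction n j rule: Stirling.induct)
  case 1
  show ?case by simp
next
  case (2 k)
  have "(\<Sum>i\<le>Suc k. (-1) ^ (Suc k - i) * real i ^ 0 / (fact (Suc k - i) * fact i))
      = (\<Sum>i\<le>Suc k. of_nat (Suc k choose i) * 1 ^ i * (-1) ^ (Suc k - i)) / fact (Suc k)"
    unfolding sum_divide_distrib
    by (rule sum.cong) (simp_all add: binomial_fact field_simps del: fact_Suc)
  also have "\<dots> = 0"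
    by (subst binomial_ring [symmetric]) simp
  finally show ?case by simp
next
  case (3 n)
  show ?case by simp
next
  case (4 n k)
  let ?t = "\<lambda>n k i. (-1) ^ (k - i) * real i ^ n / (fact (k - i) * fact i)"
  have *: "?t (Suc n) (Suc k) i - real (Suc k) * ?t n (Suc k) i = ?t n k i" if "i \<le> k" for i
  proof -
    define d where "d = k - i"
    have k: "k = i + d" using that by (simp add: d_def)
    show ?thesis unfolding k by (simp add: Suc_diff_le divide_simps del: of_nat_Suc)
        (simp add: algebra_simps)
  qed
  have "(\<Sum>i\<le>Suc k. ?t (Suc n) (Suc k) i) - real (Suc k) * (\<Sum>i\<le>Suc k. ?t n (Suc k) i)
      = (\<Sum>i\<le>Suc k. ?t (Suc n) (Suc k) i - real (Suc k) * ?t n (Suc k) i)"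
    by (simp only: sum_subtractf sum_distrib_left)
  also have "\<dots> = (\<Sum>i\<le>k. ?t (Suc n) (Suc k) i - real (Suc k) * ?t n (Suc k) i)"
    by (simp add: field_simps del: fact_Suc)
  also have "\<dots> = (\<Sum>i\<le>k. ?t n k i)"
    by (rule sum.cong) (use * in auto)
  finally have "(\<Sum>i\<le>Suc k. ?t (Suc n) (Suc k) i)
      = real (Suc k) * real (Stirling n (Suc k)) + real (Stirling n k)"
    unfolding 4 by linarith
  then show ?case
    by (simp only: Stirling.simps of_nat_add of_nat_mult)
qed

definition bell_poly :: "nat \<Rightarrow> real poly" where
  "bell_poly n = (\<Sum>j\<le>n. monom (real (Stirling n j)) j)"

definition bell_neg_zeros :: "nat \<Rightarrow> real set" where
  "bell_neg_zeros n = {x. x < 0 \<and> poly (bell_poly n) x = 0}"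

text \<open>The negative zeros are listed in decreasing order and counted from 1, so \<open>m = 1\<close> gives the
  one closest to 0. They are simple, so listing them without multiplicity loses nothing. The value
  is meaningful only for \<open>1 \<le> m \<le> n - 1\<close>.\<close>

definition bell_zeta :: "nat \<Rightarrow> nat \<Rightarrow> real" where
  "bell_zeta m n = rev (sorted_list_of_set (bell_neg_zeros n)) ! (m - 1)"

end

theory Submission
  imports Defs
begin

text \<open>The proof does not use that the zeros are real or simple. Put \<open>r = i / (i + 1)\<close>. At
  \<open>x = - t r\<^sup>n\<close> the polynomial \<open>\<B>\<^sub>n\<^sub>+\<^sub>1\<close> is dominated by its terms of degree
  \<open>i\<close> and \<open>i + 1\<close>, because \<open>j r\<^sup>j\<close> is maximal exactly for \<open>j = i\<close> and
  \<open>j = i + 1\<close>. The quotient by the absolute value of the term of degree \<open>i\<close> tends to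
  \<open>(-1)\<^sup>i (1 - t / i)\<close>, which changes sign at \<open>t = i\<close> and so gives a zero
  near \<open>- i r\<^sup>n\<close>. For \<open>i = m\<close>, the derivative of order \<open>m + 1\<close> has no zero on
  \<open>[- t r\<^sup>n, 0]\<close> for large \<open>n\<close>, so by Rolle's theorem there are no further zeros in
  this interval than \<open>0\<close> and the ones found for \<open>i = 1, \<dots>, m\<close>.\<close>

section \<open>Counting zeros\<close>

text \<open>Rolle between neighbouring zeros. The induction removes the largest zero and gains one
  critical point between the two largest.\<close>

lemma poly_zeros_pderiv:
  fixes p :: "real poly"
  assumes "finite A" "card A = Suc k" "A \<subseteq> {a..b}" "\<forall>x\<in>A. poly p x = 0"
  shows "\<exists>B. finite B \<and> card B = k \<and> B \<subseteq> {a..b} \<and> (\<forall>x\<in>B. poly (pderiv p) x = 0)"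
  using assms
proof (induction k arbitrary: A b)
  case 0
  show ?case by (rule exI[of _ "{}"]) simp
next
  case (Suc k)
  define M where "M = Max A"
  define A' where "A' = A - {M}"
  define M' where "M' = Max A'"
  have "A \<noteq> {}" using Suc.prems by auto
  then have M: "M \<in> A" unfolding M_def using Suc.prems by simp
  have A': "finite A'" "card A' = Suc k"
    using Suc.prems M by (auto simp: A'_def)
  then have "A' \<noteq> {}" by auto
  then have M': "M' \<in> A'" unfolding M'_def using A' by simp
  have le: "x \<le> M'" if "x \<in> A'" for x
    unfolding M'_def using that A' by simp
  have "M' \<le> M" using M' Suc.prems unfolding M_def A'_def by auto
  then have less: "M' < M" using M' by (auto simp: A'_def less_le)
  \<comment> \<open>Shrinking the interval to end at \<open>M'\<close> keeps the inductive critical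
    points away from the new one, which lies strictly to the right of \<open>M'\<close>.\<close>
  have "A' \<subseteq> {a..M'}"
  proof
    fix x assume "x \<in> A'"
    then show "x \<in> {a..M'}" using le[of x] Suc.prems(3) by (auto simp: A'_def)
  qed
  moreover have "\<forall>x\<in>A'. poly p x = 0" using Suc.prems(4) by (auto simp: A'_def)
  ultimately obtain B where B: "finite B" "card B = k" "B \<subseteq> {a..M'}"
      "\<forall>x\<in>B. poly (pderiv p) x = 0"
    using Suc.IH[OF A'(1,2)] by blast
  have "poly p M = 0" "poly p M' = 0" using M M' Suc.prems(4) by (auto simp: A'_def)
  then obtain c where c: "M' < c" "c < M" "poly (pderiv p) c = 0"
    using poly_MVT[OF less, of p] less by auto
  have "c \<notin> B" "a \<le> M'" "M \<le> b" using B c M M' Suc.prems(3) by (auto simp: A'_def)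
  then show ?case
    using B c by (intro exI[of _ "insert c B"]) auto
qed

text \<open>Iterated Rolle, to be used in the contrapositive: if the derivative of order
  \<open>k\<close> has no zero on the interval, the polynomial has at most \<open>k\<close> distinct
  zeros there.\<close>

lemma poly_zeros_higher_pderiv:
  fixes p :: "real poly"
  assumes "finite A" "k < card A" "A \<subseteq> {a..b}" "\<forall>x\<in>A. poly p x = 0"
  shows "\<exists>x\<in>{a..b}. poly ((pderiv ^^ k) p) x = 0"
  using assms
proof (induction k arbitrary: A p)
  case 0
  then obtain x where "x \<in> A" by (auto simp: card_gt_0_iff)
  then show ?case using 0 by auto
next
  case (Suc k)
  obtain l where l: "card A = Suc l" using Suc.prems(2) by (cases "card A") auto
  from poly_zeros_pderiv[OF Suc.prems(1) l Suc.prems(3,4)] obtain B where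
    "finite B" "card B = l" "B \<subseteq> {a..b}" "\<forall>x\<in>B. poly (pderiv p) x = 0" by blast
  then show ?case
    using Suc.IH[of B "pderiv p"] Suc.prems(2) l by (simp add: funpow_Suc_right del: funpow.simps)
qed

text \<open>The elements larger than \<open>x\<close> are exactly those behind \<open>x\<close> in
  the increasing list. This reduces identifying \<open>bell_zeta\<close> to counting the zeros
  closer to 0.\<close>

lemma nth_rev_sorted_list_of_set:
  fixes Z :: "'a::linorder set"
  assumes "finite Z" "x \<in> Z" "card {y\<in>Z. x < y} = k"
  shows "rev (sorted_list_of_set Z) ! k = x"
proof -
  define L where "L = sorted_list_of_set Z"
  have L: "sorted_wrt (<) L" "set L = Z" "distinct L"
    using assms(1) by (auto simp: L_def)
  obtain i where i: "i < length L" "L ! i = x"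
    using L(2) assms(2) by (metis in_set_conv_nth)
  have "{y\<in>Z. x < y} = set (drop (Suc i) L)"
  proof (intro set_eqI iffI)
    fix y assume "y \<in> {y\<in>Z. x < y}"
    then obtain j where j: "j < length L" "L ! j = y" "x < y"
      using L(2) by (auto simp: in_set_conv_nth)
    have "i < j"
      using sorted_wrt_nth_less[OF L(1), of j i] i j by (cases i j rule: linorder_cases) auto
    then show "y \<in> set (drop (Suc i) L)"
      using j by (auto simp: in_set_conv_nth intro!: exI[of _ "j - Suc i"])
  next
    fix y assume "y \<in> set (drop (Suc i) L)"
    then obtain j where "j < length (drop (Suc i) L)" "y = drop (Suc i) L ! j"
      by (metis in_set_conv_nth)
    then have j: "Suc i + j < length L" "y = L ! (Suc i + j)" by auto
    then show "y \<in> {y\<in>Z. x < y}"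
      using sorted_wrt_nth_less[OF L(1), of i "Suc i + j"] i L(2) by auto
  qed
  then have "card {y\<in>Z. x < y} = length L - Suc i"
    using L(3) by (simp add: distinct_card)
  then show ?thesis
    using i assms(3) by (simp add: rev_nth flip: L_def)
qed

section \<open>Growth of the Stirling numbers\<close>

text \<open>Here \<open>fact j * (x choose j)\<close> is the falling factorial of \<open>x\<close>
  of length \<open>j\<close>. Multiplying it by \<open>x\<close> gives \<open>j\<close> times itself
  plus the next one, which matches the Stirling recurrence.\<close>

lemma power_eq_sum_Stirling:
  "x ^ n = (\<Sum>j\<le>n. Stirling n j * fact j * (x choose j))" for x :: nat
proof (induction n)
  case 0
  show ?case by simp
next
  case (Suc n)
  have *: "x * (fact j * (x choose j)) = j * (fact j * (x choose j)) + fact (Suc j) * (x choose Suc j)"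
    for j
  proof -
    have "Suc j * (x choose Suc j) = (x - j) * (x choose j)"
      by (metis binomial_absorb_comp binomial_absorption)
    then have eq: "fact (Suc j) * (x choose Suc j) = fact j * ((x - j) * (x choose j))"
      by (metis (no_types, lifting) fact_Suc mult.assoc mult.left_commute of_nat_id)
    \<comment> \<open>For \<open>j > x\<close> the subtraction is truncated, but then the binomial
      coefficient is 0.\<close>
    have "x * (x choose j) = j * (x choose j) + (x - j) * (x choose j)"
      by (cases "j \<le> x") (simp_all flip: add_mult_distrib)
    then have "x * (fact j * (x choose j)) = fact j * (j * (x choose j) + (x - j) * (x choose j))"
      by (metis mult.left_commute)
    then show ?thesis
      by (metis eq distrib_left mult.left_commute)
  qed
  let ?g = "\<lambda>j. fact j * (x choose j)"
  have "x ^ Suc n = (\<Sum>j\<le>n. Stirling n j * (x * ?g j))"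
    unfolding power_Suc Suc.IH sum_distrib_left by (intro sum.cong) (simp_all add: ac_simps)
  also have "\<dots> = (\<Sum>j\<le>n. j * Stirling n j * ?g j) + (\<Sum>j\<le>n. Stirling n j * ?g (Suc j))"
    unfolding * by (simp only: distrib_left sum.distrib mult_ac)
  \<comment> \<open>The added term vanishes because \<open>Stirling n (Suc n) = 0\<close>; after
    that the term at 0 drops out and the index can be shifted.\<close>
  also have "(\<Sum>j\<le>n. j * Stirling n j * ?g j) = (\<Sum>j\<le>Suc n. j * Stirling n j * ?g j)"
    by simp
  also have "\<dots> = (\<Sum>j\<le>n. Suc j * Stirling n (Suc j) * ?g (Suc j))"
    by (subst sum.atMost_Suc_shift) simp
  also have "\<dots> + (\<Sum>j\<le>n. Stirling n j * ?g (Suc j))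
      = (\<Sum>j\<le>n. Stirling (Suc n) (Suc j) * ?g (Suc j))"
    by (simp only: Stirling.simps distrib_right sum.distrib)
  also have "\<dots> = (\<Sum>j\<le>Suc n. Stirling (Suc n) j * ?g j)"
    by (subst sum.atMost_Suc_shift) simp
  finally show ?case by (simp only: mult.assoc)
qed

text \<open>The left side is the summand of index \<open>j\<close> in the expansion of
  \<open>j ^ n\<close>, whose summands are all nonnegative.\<close>

lemma Stirling_fact_le: "Stirling n j * fact j \<le> j ^ n"
proof (cases "j \<le> n")
  case True
  then have "Stirling n j * fact j * (j choose j) \<le> (\<Sum>i\<le>n. Stirling n i * fact i * (j choose i))"
    by (intro member_le_sum) auto
  then show ?thesis by (simp flip: power_eq_sum_Stirling)
qed simp

text \<open>The quotient of \<open>Stirling n j\<close> by the main term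
  \<open>j ^ n / fact j\<close> of its explicit formula. For \<open>j > 0\<close> it is the
  proportion of surjections among the maps from an \<open>n\<close>-set to a
  \<open>j\<close>-set.\<close>

definition Stirling_ratio :: "nat \<Rightarrow> nat \<Rightarrow> real" where
  "Stirling_ratio n j = real (Stirling n j) * fact j / real j ^ n"

lemma Stirling_ratio_nonneg: "0 \<le> Stirling_ratio n j"
  by (simp add: Stirling_ratio_def)

lemma Stirling_ratio_le_1: "Stirling_ratio n j \<le> 1"
proof -
  have "real (Stirling n j * fact j) \<le> real (j ^ n)"
    using Stirling_fact_le by (simp only: of_nat_le_iff)
  then have "Stirling_ratio n j \<le> real j ^ n / real j ^ n"
    unfolding Stirling_ratio_def by (intro divide_right_mono) simp_all
  also have "\<dots> \<le> 1" by simp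
  finally show ?thesis .
qed

lemma Stirling_eq_ratio:
  "real (Stirling (Suc n) j) = Stirling_ratio (Suc n) j * real j ^ Suc n / fact j"
  by (cases "j = 0") (simp_all add: Stirling_ratio_def)

text \<open>After division by the main term, the explicit formula is a fixed combination of the
  powers \<open>(i / j) ^ n\<close>; only \<open>i = j\<close> survives, with coefficient 1.\<close>

lemma Stirling_ratio_tendsto:
  assumes "j \<ge> 1"
  shows "(\<lambda>n. Stirling_ratio n j) \<longlonglongrightarrow> 1"
proof -
  define c :: "nat \<Rightarrow> real" where "c i = (-1) ^ (j - i) * fact j / (fact (j - i) * fact i)" for i
  have eq: "Stirling_ratio n j = (\<Sum>i\<le>j. c i * (real i / real j) ^ n)" for n
    unfolding Stirling_ratio_def Stirling_explicit sum_distrib_right sum_divide_distrib c_def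
    by (intro sum.cong) (simp_all add: power_divide)
  have lim: "(\<lambda>n. c i * (real i / real j) ^ n) \<longlonglongrightarrow> (if i = j then 1 else 0)" if "i \<le> j" for i
  proof (cases "i = j")
    case True
    then show ?thesis using assms by (simp add: c_def)
  next
    case False
    then have "(\<lambda>n. (real i / real j) ^ n) \<longlonglongrightarrow> 0"
      using that by (intro LIMSEQ_power_zero) (simp add: field_simps)
    then show ?thesis using False tendsto_mult_right_zero by fastforce
  qed
  have "(\<lambda>n. \<Sum>i\<le>j. c i * (real i / real j) ^ n) \<longlonglongrightarrow> (\<Sum>i\<le>j. if i = j then 1 else 0)"
    using lim by (intro tendsto_sum) auto
  then show ?thesis by (simp add: eq)
qed

section \<open>Comparing terms of different degree\<close>

text \<open>The size of the term of degree \<open>j\<close>, relative to the term of degree \<open>i\<close>, is of order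
  \<open>peak_ratio i j ^ n\<close>.\<close>

definition peak_ratio :: "nat \<Rightarrow> nat \<Rightarrow> real" where
  "peak_ratio i j = real j * (real i / real (Suc i)) ^ j / (real i * (real i / real (Suc i)) ^ i)"

lemma peak_ratio_nonneg: "0 \<le> peak_ratio i j"
  by (simp add: peak_ratio_def)

lemma peak_ratio_self: "i \<ge> 1 \<Longrightarrow> peak_ratio i i = 1"
  by (simp add: peak_ratio_def)

lemma peak_ratio_Suc: "i \<ge> 1 \<Longrightarrow> peak_ratio i (Suc i) = 1"
  by (simp add: peak_ratio_def field_simps del: of_nat_Suc)

text \<open>With \<open>r = i / (i + 1)\<close>, the increment of \<open>j * r ^ j\<close> from
  \<open>j\<close> to \<open>j + 1\<close> has the sign of \<open>i - j\<close>: the sequence rises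
  up to \<open>i\<close>, is level from \<open>i\<close> to \<open>i + 1\<close> and falls
  afterwards.\<close>

lemma peak_ratio_less_1:
  assumes "i \<ge> 1" "j \<noteq> i" "j \<noteq> Suc i"
  shows "peak_ratio i j < 1"
proof -
  define r where "r = real i / real (Suc i)"
  define f where "f j = real j * r ^ j" for j
  have r: "r > 0" using assms(1) by (simp add: r_def)
  have step: "f (Suc j) - f j = r ^ j * (real i - real j) / real (Suc i)" for j
  proof -
    have "f (Suc j) - f j = r ^ j * (real (Suc j) * r - real j)"
      by (simp add: f_def algebra_simps)
    also have "real (Suc j) * r - real j = (real i - real j) / real (Suc i)"
      by (simp add: r_def field_simps)
    finally show ?thesis by simp
  qed
  have up: "f j < f (Suc j)" if "j < i" for j
  proof -
    have "r ^ j * (real i - real j) / real (Suc i) > 0"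
      using r that by (intro divide_pos_pos mult_pos_pos) auto
    then show ?thesis using step[of j] by linarith
  qed
  have down: "f (Suc j) < f j" if "i < j" for j
  proof -
    have "r ^ j * (real i - real j) / real (Suc i) < 0"
      using r that by (intro divide_neg_pos mult_pos_neg) auto
    then show ?thesis using step[of j] by linarith
  qed
  have "f i = f (Suc i)" using step[of i] by simp
  have "f j < f i"
  proof (cases "j < i")
    case True
    then show ?thesis
    proof (induction j rule: strict_inc_induct)
      case (base k)
      then show ?case using up[of k] by simp
    next
      case (step k)
      then show ?case using up[of k] by simp
    qed
  next
    case False
    then have "Suc (Suc i) \<le> j" using assms by auto
    then have "f j < f (Suc i)"
    proof (induction j rule: dec_induct)
      case base
      show ?case by (rule down) simp
    next
      case (step k)
      then show ?case using down[of k] by simp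
    qed
    with \<open>f i = f (Suc i)\<close> show ?thesis by simp
  qed
  moreover have "f i > 0" using r assms(1) by (simp add: f_def)
  ultimately show ?thesis by (simp add: peak_ratio_def f_def r_def)
qed

lemma peak_ratio_le_1: "i \<ge> 1 \<Longrightarrow> peak_ratio i j \<le> 1"
  using peak_ratio_less_1[of i j] peak_ratio_self peak_ratio_Suc by fastforce

lemma Stirling_peak_tendsto:
  assumes "i \<ge> 1"
  shows "(\<lambda>n. Stirling_ratio (Suc n) j * peak_ratio i j ^ n)
           \<longlonglongrightarrow> (if j = i \<or> j = Suc i then 1 else 0)"
proof (cases "j = i \<or> j = Suc i")
  case True
  then have "(\<lambda>n. Stirling_ratio (Suc n) j) \<longlonglongrightarrow> 1"
    using assms by (intro LIMSEQ_Suc Stirling_ratio_tendsto) auto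
  then show ?thesis using True assms by (auto simp: peak_ratio_self peak_ratio_Suc)
next
  case False
  then have "(\<lambda>n. peak_ratio i j ^ n) \<longlonglongrightarrow> 0"
    using assms peak_ratio_less_1 peak_ratio_nonneg by (intro LIMSEQ_power_zero) simp
  then have "(\<lambda>n. Stirling_ratio (Suc n) j * peak_ratio i j ^ n) \<longlonglongrightarrow> 0"
    by (rule Lim_null_comparison[rotated])
      (auto simp: Stirling_ratio_nonneg Stirling_ratio_le_1 peak_ratio_nonneg
        intro!: always_eventually mult_left_le_one_le)
  then show ?thesis using False by simp
qed

text \<open>Uniformity in \<open>n\<close> and \<open>j\<close>, for the majorants in the
  applications of Tannery's theorem below.\<close>

lemma Stirling_peak_bound:
  assumes "i \<ge> 1"
  shows "\<bar>Stirling_ratio (Suc n) j * peak_ratio i j ^ n\<bar> \<le> 1"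
  using assms Stirling_ratio_nonneg Stirling_ratio_le_1 peak_ratio_nonneg peak_ratio_le_1
  by (auto simp: abs_mult power_abs intro!: mult_le_one power_le_one)

section \<open>Asymptotics of the Bell polynomials near 0\<close>

lemma coeff_bell_poly: "coeff (bell_poly n) j = real (Stirling n j)"
  by (simp add: bell_poly_def coeff_sum)

lemma bell_poly_nonzero: "bell_poly n \<noteq> 0"
  using coeff_bell_poly[of n n] by auto

lemma poly_bell_poly_0: "poly (bell_poly (Suc n)) 0 = 0"
  by (simp add: poly_0_coeff_0 coeff_bell_poly)

text \<open>The degree of the Bell polynomial grows with \<open>n\<close>; as a series its summation
  range is independent of \<open>n\<close>, so limits can be taken termwise.\<close>

lemma poly_suminf: "poly p x = (\<Sum>j. coeff p j * x ^ j)" for x :: real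
  unfolding poly_altdef by (intro suminf_finite[symmetric]) (auto simp: coeff_eq_0 not_le)

lemma tannery_sequentially:
  fixes a :: "nat \<Rightarrow> nat \<Rightarrow> real"
  assumes "\<And>k. (\<lambda>n. a k n) \<longlonglongrightarrow> b k" "\<And>k n. \<bar>a k n\<bar> \<le> M k" "summable M"
  shows "(\<lambda>n. \<Sum>k. a k n) \<longlonglongrightarrow> (\<Sum>k. b k)"
proof -
  have "\<forall>\<^sub>F (k, n) in sequentially \<times>\<^sub>F sequentially. norm (a k n) \<le> M k"
    by (rule always_eventually) (use assms(2) in auto)
  from tannerys_theorem[OF assms(1) this assms(3)] show ?thesis by simp
qed

text \<open>For \<open>t > 0\<close>, the absolute value of the term of degree \<open>i\<close> at
  \<open>- t * (i / (i + 1)) ^ n\<close>, with the Stirling number replaced by its main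
  term.\<close>

definition bell_scale :: "nat \<Rightarrow> real \<Rightarrow> nat \<Rightarrow> real" where
  "bell_scale i t n = real i ^ Suc n / fact i * (t * (real i / real (Suc i)) ^ n) ^ i"

lemma poly_bell_poly_tendsto:
  assumes i: "i \<ge> 1" and t: "t > 0"
  shows "(\<lambda>n. poly (bell_poly (Suc n)) (- t * (real i / real (Suc i)) ^ n) / bell_scale i t n)
           \<longlonglongrightarrow> (-1) ^ i * (1 - t / real i)"
proof -
  define r where "r = real i / real (Suc i)"
  have r: "r > 0" using i by (simp add: r_def)
  \<comment> \<open>\<open>K\<close> collects the factors free of \<open>n\<close>; all dependence
    on \<open>n\<close> goes into \<open>u\<close>, which is bounded by 1 and tends to 1 or
    0.\<close>
  define K where "K j = (- t) ^ j / fact j * real j * (fact i / (t ^ i * real i))" for j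
  define u where "u j n = Stirling_ratio (Suc n) j * peak_ratio i j ^ n" for j n
  have pow: "(c * r ^ n) ^ j = c ^ j * (r ^ j) ^ n" for c j n
    by (simp add: power_mult_distrib mult.commute flip: power_mult)
  have term_eq: "coeff (bell_poly (Suc n)) j * (- t * r ^ n) ^ j / bell_scale i t n = K j * u j n" for j n
  proof -
    have "coeff (bell_poly (Suc n)) j * (- t * r ^ n) ^ j / bell_scale i t n
        = Stirling_ratio (Suc n) j * (real j * real j ^ n) / fact j * ((- t) ^ j * (r ^ j) ^ n)
          / (real i * real i ^ n / fact i * (t ^ i * (r ^ i) ^ n))"
      unfolding coeff_bell_poly Stirling_eq_ratio bell_scale_def r_def[symmetric] pow power_Suc
      by simp
    also have "\<dots> = K j * u j n"
      unfolding K_def u_def peak_ratio_def r_def[symmetric]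
      using i t r by (simp add: power_divide power_mult_distrib field_simps)
    finally show ?thesis .
  qed
  have "(\<lambda>n. \<Sum>j. K j * u j n) \<longlonglongrightarrow> (\<Sum>j. K j * (if j = i \<or> j = Suc i then 1 else 0))"
  proof (rule tannery_sequentially)
    show "(\<lambda>n. K j * u j n) \<longlonglongrightarrow> K j * (if j = i \<or> j = Suc i then 1 else 0)" for j
      unfolding u_def by (intro tendsto_mult_left Stirling_peak_tendsto i)
    show "\<bar>K j * u j n\<bar> \<le> (2 * t) ^ j / fact j * (fact i / (t ^ i * real i))" for j n
    proof -
      have "\<bar>K j * u j n\<bar> \<le> \<bar>K j\<bar>"
        using Stirling_peak_bound[OF i] by (simp add: u_def abs_mult mult_left_le)
      also have "\<bar>K j\<bar> = t ^ j / fact j * real j * (fact i / (t ^ i * real i))"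
        using t by (simp add: K_def abs_mult power_abs)
      \<comment> \<open>Absorbing \<open>j\<close> into \<open>2 ^ j\<close> gives a multiple of the
        exponential series at \<open>2 * t\<close>.\<close>
      also have "\<dots> \<le> t ^ j / fact j * 2 ^ j * (fact i / (t ^ i * real i))"
        using t of_nat_less_two_power[of j, where 'a = real]
        by (intro mult_right_mono mult_left_mono) auto
      finally show ?thesis by (simp add: power_mult_distrib mult_ac)
    qed
    show "summable (\<lambda>j. (2 * t) ^ j / fact j * (fact i / (t ^ i * real i)))"
      using summable_exp[of "2 * t"] by (intro summable_mult2) (simp add: field_simps)
  qed
  also have "(\<Sum>j. K j * (if j = i \<or> j = Suc i then 1 else 0)) = K i + K (Suc i)"
    by (subst suminf_finite[of "{i, Suc i}"]) auto
  also have "K i = (- t) ^ i / t ^ i"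
    using i by (simp add: K_def)
  also have "K (Suc i) = - t * ((- t) ^ i / t ^ i) / real i"
    by (simp add: K_def del: of_nat_Suc)
  also have "(- t) ^ i / t ^ i = (-1) ^ i"
    using t by (simp add: power_minus[of t])
  also have "(-1) ^ i + - t * (-1) ^ i / real i = (-1) ^ i * (1 - t / real i)"
    by (simp add: algebra_simps)
  also have "(\<lambda>n. \<Sum>j. K j * u j n)
      = (\<lambda>n. poly (bell_poly (Suc n)) (- t * r ^ n) / bell_scale i t n)"
  proof
    fix n
    have "summable (\<lambda>j. coeff (bell_poly (Suc n)) j * (- t * r ^ n) ^ j)"
      by (rule summable_finite[of "{..degree (bell_poly (Suc n))}"]) (auto simp: coeff_eq_0 not_le)
    then show "(\<Sum>j. K j * u j n) = poly (bell_poly (Suc n)) (- t * r ^ n) / bell_scale i t n"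
      unfolding poly_suminf by (subst suminf_divide[symmetric]) (simp_all only: term_eq)
  qed
  finally show ?thesis by (simp add: r_def)
qed

text \<open>The constant term of the derivative, \<open>fact (m + 1)\<close> times
  \<open>Stirling (n + 1) (m + 1)\<close>, is asymptotic to \<open>(m + 1) ^ (n + 1)\<close> and
  dominates all others. An arbitrary sequence \<open>y\<close> yields uniformity on the whole
  interval.\<close>

lemma higher_pderiv_bell_poly_tendsto:
  assumes m: "m \<ge> 1" and t: "t > 0" and y: "\<And>n. \<bar>y n\<bar> \<le> t * (real m / real (Suc m)) ^ n"
  shows "(\<lambda>n. poly ((pderiv ^^ Suc m) (bell_poly (Suc n))) (y n) / real (Suc m) ^ Suc n) \<longlonglongrightarrow> 1"
proof -
  define r where "r = real m / real (Suc m)"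
  have r: "r > 0" using m by (simp add: r_def)
  define u where "u J n = Stirling_ratio (Suc n) J * peak_ratio m J ^ n" for J n
  define a where "a j n = coeff ((pderiv ^^ Suc m) (bell_poly (Suc n))) j * y n ^ j / real (Suc m) ^ Suc n"
    for j n
  define K where "K j = t ^ j / fact j * (real (j + Suc m) / real (Suc m))" for j
  have a_eq: "a j n = Stirling_ratio (Suc n) (j + Suc m) * real (j + Suc m) ^ Suc n
      / real (Suc m) ^ Suc n / fact j * y n ^ j" for j n
  proof -
    have "fact (j + Suc m) = fact j * pochhammer (real (Suc j)) (Suc m)"
      using pochhammer_product'[of "1::real" j "Suc m"] by (simp add: pochhammer_fact add.commute)
    moreover have "fact (j + Suc m) \<noteq> (0::real)" by simp
    ultimately have "pochhammer (real (Suc j)) (Suc m) / fact (j + Suc m) = 1 / (fact j :: real)"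
      by (simp add: divide_simps del: fact_Suc of_nat_Suc)
    moreover have "a j n = pochhammer (real (Suc j)) (Suc m) / fact (j + Suc m)
        * (Stirling_ratio (Suc n) (j + Suc m) * real (j + Suc m) ^ Suc n / real (Suc m) ^ Suc n * y n ^ j)"
      unfolding a_def coeff_higher_pderiv coeff_bell_poly Stirling_eq_ratio by simp
    ultimately show ?thesis by simp
  qed
  \<comment> \<open>Degrees \<open>m\<close> and \<open>m + 1\<close> are both peaks, so
    \<open>peak_ratio m\<close> equally measures terms against degree \<open>m + 1\<close>, the
    constant term here.\<close>
  have peak: "peak_ratio m (j + Suc m) = real (j + Suc m) / real (Suc m) * r ^ j" for j
  proof -
    have "peak_ratio m (j + Suc m) = real (j + Suc m) * r ^ j * (r / real m)"
      using r unfolding peak_ratio_def r_def[symmetric] by (simp add: power_add)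
    also have "r / real m = 1 / real (Suc m)" using m by (simp add: r_def)
    finally show ?thesis by simp
  qed
  have bound: "\<bar>a j n\<bar> \<le> K j * u (j + Suc m) n" for j n
  proof -
    have "\<bar>a j n\<bar> = Stirling_ratio (Suc n) (j + Suc m) * real (j + Suc m) ^ Suc n
      / real (Suc m) ^ Suc n / fact j * \<bar>y n\<bar> ^ j"
      unfolding a_eq by (simp add: abs_mult power_abs Stirling_ratio_nonneg)
    also have "\<dots> \<le> Stirling_ratio (Suc n) (j + Suc m) * real (j + Suc m) ^ Suc n
      / real (Suc m) ^ Suc n / fact j * (t * r ^ n) ^ j"
      using y[of n] by (intro mult_left_mono power_mono)
        (auto simp: r_def Stirling_ratio_nonneg simp del: of_nat_Suc)
    also have "(t * r ^ n) ^ j = t ^ j * (r ^ j) ^ n"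
      by (simp add: power_mult_distrib mult.commute flip: power_mult)
    finally show ?thesis
      unfolding K_def u_def peak power_mult_distrib power_divide
      by (simp add: mult_ac del: of_nat_Suc of_nat_add)
  qed
  have K: "K j \<ge> 0" for j using t by (simp add: K_def)
  have "(\<lambda>n. \<Sum>j. a j n) \<longlonglongrightarrow> (\<Sum>j. if j = 0 then 1 else 0)"
  proof (rule tannery_sequentially)
    show "(\<lambda>n. a j n) \<longlonglongrightarrow> (if j = 0 then 1 else 0)" for j
    proof (cases "j = 0")
      case True
      have "(\<lambda>n. Stirling_ratio (Suc n) (Suc m)) \<longlonglongrightarrow> 1"
        by (intro LIMSEQ_Suc Stirling_ratio_tendsto) auto
      then show ?thesis
        unfolding a_eq using True by (simp del: of_nat_Suc)
    next
      case False
      then have "u (j + Suc m) \<longlonglongrightarrow> 0"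
        unfolding u_def using Stirling_peak_tendsto[OF m, of "j + Suc m"] by simp
      then have "(\<lambda>n. K j * u (j + Suc m) n) \<longlonglongrightarrow> 0"
        by (rule tendsto_mult_right_zero)
      then have "a j \<longlonglongrightarrow> 0"
        by (rule Lim_null_comparison[rotated]) (use bound in auto)
      then show ?thesis using False by simp
    qed
    show "\<bar>a j n\<bar> \<le> (2 * t) ^ j / fact j * real (Suc m)" for j n
    proof -
      have "\<bar>a j n\<bar> \<le> K j * u (j + Suc m) n" by (rule bound)
      also have "\<dots> \<le> K j"
        using Stirling_peak_bound[OF m, of n "j + Suc m"] K[of j] by (simp add: u_def mult_left_le)
      also have "\<dots> \<le> t ^ j / fact j * (2 ^ j * real (Suc m))"
      proof -
        have "Suc j \<le> 2 ^ j" by (rule Suc_leI[OF less_exp])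
        then have "(j + Suc m) * 1 \<le> (Suc j * Suc m) * Suc m" "Suc j * (Suc m * Suc m) \<le> 2 ^ j * (Suc m * Suc m)"
          by (simp_all only: mult_le_mono) (simp add: algebra_simps)
        then have "j + Suc m \<le> 2 ^ j * (Suc m * Suc m)" by (simp add: mult.assoc)
        then have "real (j + Suc m) \<le> 2 ^ j * (real (Suc m) * real (Suc m))"
          by (metis of_nat_le_iff of_nat_mult of_nat_numeral of_nat_power)
        then have "real (j + Suc m) / real (Suc m) \<le> 2 ^ j * real (Suc m)"
          by (simp add: divide_le_eq mult.assoc del: of_nat_Suc of_nat_add)
        then show ?thesis unfolding K_def using t by (intro mult_left_mono) auto
      qed
      finally show ?thesis by (simp add: power_mult_distrib mult_ac)
    qed
    show "summable (\<lambda>j. (2 * t) ^ j / fact j * real (Suc m))"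
      using summable_exp[of "2 * t"] by (intro summable_mult2) (simp add: field_simps)
  qed
  also have "(\<Sum>j. if j = 0 then 1 else 0 :: real) = 1"
    by (subst suminf_finite[of "{0}"]) auto
  also have "(\<lambda>n. \<Sum>j. a j n)
      = (\<lambda>n. poly ((pderiv ^^ Suc m) (bell_poly (Suc n))) (y n) / real (Suc m) ^ Suc n)"
  proof
    fix n
    let ?p = "(pderiv ^^ Suc m) (bell_poly (Suc n))"
    have "summable (\<lambda>j. coeff ?p j * y n ^ j)"
      by (rule summable_finite[of "{..degree ?p}"]) (auto simp: coeff_eq_0 not_le)
    then show "(\<Sum>j. a j n) = poly ?p (y n) / real (Suc m) ^ Suc n"
      unfolding poly_suminf a_def by (subst suminf_divide[symmetric]) simp_all
  qed
  finally show ?thesis .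
qed

section \<open>Locating the zeros\<close>

text \<open>The limit \<open>(-1) ^ i * (1 - t / i)\<close> has opposite signs at
  \<open>t = i + e\<close> and \<open>t = i - e\<close>, so the intermediate value theorem applies.
  Taking the product of the two values avoids a case split on the parity of
  \<open>i\<close>.\<close>

lemma eventually_bell_zero_in_window:
  assumes i: "i \<ge> 1" and e: "0 < e" "e < 1"
  shows "\<forall>\<^sub>F n in sequentially. \<exists>x. - (real i + e) * (real i / real (Suc i)) ^ n < x
    \<and> x < - (real i - e) * (real i / real (Suc i)) ^ n \<and> poly (bell_poly (Suc n)) x = 0"
proof -
  define r where "r = real i / real (Suc i)"
  define P where "P t n = poly (bell_poly (Suc n)) (- t * r ^ n)" for t n
  have r: "r > 0" using i by (simp add: r_def)
  have pos: "real i + e > 0" "real i - e > 0" using i e by auto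
  have lim: "(\<lambda>n. P t n / bell_scale i t n) \<longlonglongrightarrow> (-1) ^ i * (1 - t / real i)" if "t > 0" for t
    using poly_bell_poly_tendsto[OF i that] by (simp add: P_def r_def)
  have "(\<lambda>n. P (real i + e) n / bell_scale i (real i + e) n
        * (P (real i - e) n / bell_scale i (real i - e) n))
      \<longlonglongrightarrow> (-1) ^ i * (1 - (real i + e) / real i) * ((-1) ^ i * (1 - (real i - e) / real i))"
    by (intro tendsto_mult lim pos)
  also have "(-1) ^ i * (1 - (real i + e) / real i) * ((-1) ^ i * (1 - (real i - e) / real i))
      = - ((e / real i)\<^sup>2)"
    using i by (simp add: field_simps power2_eq_square)
  finally have "\<forall>\<^sub>F n in sequentially. P (real i + e) n / bell_scale i (real i + e) n
        * (P (real i - e) n / bell_scale i (real i - e) n) < 0"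
    by (rule order_tendstoD(2)) (use i e in simp)
  then show ?thesis
  proof eventually_elim
    case (elim n)
    have "bell_scale i t n > 0" if "t > 0" for t
      using that i r by (simp add: bell_scale_def)
    from this[OF pos(1)] this[OF pos(2)] elim have "P (real i + e) n * P (real i - e) n < 0"
      by (auto simp: mult_less_0_iff divide_less_0_iff zero_less_divide_iff)
    moreover have "- (real i + e) * r ^ n < - (real i - e) * r ^ n"
      using r e by simp
    ultimately show ?case
      using poly_IVT unfolding P_def r_def by blast
  qed
qed

lemma eventually_no_higher_pderiv_bell_zero:
  assumes m: "m \<ge> 1" and t: "t > 0"
  shows "\<forall>\<^sub>F n in sequentially. \<forall>x\<in>{- t * (real m / real (Suc m)) ^ n..0}.
    poly ((pderiv ^^ Suc m) (bell_poly (Suc n))) x \<noteq> 0"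
proof -
  define Q where "Q n x \<longleftrightarrow> x \<in> {- t * (real m / real (Suc m)) ^ n..0}
    \<and> poly ((pderiv ^^ Suc m) (bell_poly (Suc n))) x = 0" for n x
  \<comment> \<open>A zero in the interval if there is one. The default 0 also satisfies the bound
    on \<open>y\<close>, so the limit is available along the whole sequence and excludes the first
    case for large \<open>n\<close>.\<close>
  define y where "y n = (if \<exists>x. Q n x then SOME x. Q n x else 0)" for n
  have y: "Q n (y n)" if "Q n x" for n x
    unfolding y_def using that by (auto intro: someI)
  have "\<bar>y n\<bar> \<le> t * (real m / real (Suc m)) ^ n" for n
  proof (cases "\<exists>x. Q n x")
    case True
    then have "Q n (y n)" using y by blast
    then show ?thesis by (simp add: Q_def)
  qed (use t in \<open>simp add: y_def\<close>)
  then have "(\<lambda>n. poly ((pderiv ^^ Suc m) (bell_poly (Suc n))) (y n) / real (Suc m) ^ Suc n) \<longlonglongrightarrow> 1"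
    by (rule higher_pderiv_bell_poly_tendsto[OF m t])
  then have "\<forall>\<^sub>F n in sequentially.
      0 < poly ((pderiv ^^ Suc m) (bell_poly (Suc n))) (y n) / real (Suc m) ^ Suc n"
    by (rule order_tendstoD(1)) simp
  then show ?thesis
  proof eventually_elim
    case (elim n)
    then have "\<not> Q n (y n)" unfolding Q_def by auto
    then have "\<not> Q n x" for x using y by blast
    then show ?case unfolding Q_def by blast
  qed
qed

lemma eventually_bell_zeta_in_window:
  assumes m: "m \<ge> 1" and e: "0 < e" "e \<le> 1 / 2"
  shows "\<forall>\<^sub>F n in sequentially. - (real m + e) * (real m / real (Suc m)) ^ n < bell_zeta m (Suc n)
    \<and> bell_zeta m (Suc n) < - (real m - e) * (real m / real (Suc m)) ^ n"
proof -
  define r where "r i = real i / real (Suc i)" for i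
  define W where "W n i x \<longleftrightarrow> - (real i + e) * r i ^ n < x \<and> x < - (real i - e) * r i ^ n
    \<and> poly (bell_poly (Suc n)) x = 0" for n i x
  have "\<forall>\<^sub>F n in sequentially. \<forall>i\<in>{1..m}. \<exists>x. W n i x"
    unfolding W_def r_def
    by (intro eventually_ball_finite ballI eventually_bell_zero_in_window) (use e in auto)
  moreover have "\<forall>\<^sub>F n in sequentially. \<forall>x\<in>{- (real m + e) * r m ^ n..0}.
      poly ((pderiv ^^ Suc m) (bell_poly (Suc n))) x \<noteq> 0"
    unfolding r_def by (rule eventually_no_higher_pderiv_bell_zero) (use m e in auto)
  ultimately show ?thesis
  proof eventually_elim
    case (elim n)
    let ?p = "bell_poly (Suc n)"
    let ?I = "{- (real m + e) * r m ^ n..0}"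
    obtain z where z: "\<And>i. i \<in> {1..m} \<Longrightarrow> W n i (z i)" using elim(1) by metis
    have neg: "z i < 0" if "i \<in> {1..m}" for i
    proof -
      have "(real i - e) * r i ^ n > 0" using that e by (simp add: r_def)
      then show ?thesis using z[OF that] unfolding W_def mult_minus_left by linarith
    qed
    have mono: "z k < z i" if "i < k" "i \<in> {1..m}" "k \<in> {1..m}" for i k
    proof -
      \<comment> \<open>The windows are disjoint: \<open>e \<le> 1 / 2\<close> gives
        \<open>i + e \<le> k - e\<close>, and \<open>r\<close> is increasing.\<close>
      have "(real i + e) * r i ^ n \<le> (real k - e) * r k ^ n"
        using that e by (intro mult_mono power_mono) (auto simp: r_def field_simps)
      then show ?thesis
        using z[OF that(2)] z[OF that(3)] unfolding W_def mult_minus_left by linarith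
    qed
    have inj: "inj_on z {1..m}"
      by (rule linorder_inj_onI) (use mono in force)+
    have Z: "z i \<in> bell_neg_zeros (Suc n)" if "i \<in> {1..m}" for i
      using z[OF that] neg[OF that] by (simp add: bell_neg_zeros_def W_def)
    have ge: "z m \<le> z i" if "i \<in> {1..m}" for i
      using mono[of i m] that by (cases "i = m") auto
    have zm: "- (real m + e) * r m ^ n < z m" "z m < - (real m - e) * r m ^ n"
      using z[of m] m by (auto simp: W_def)
    \<comment> \<open>Exactly \<open>m - 1\<close> negative zeros exceed \<open>z m\<close>, which
      is the list index in \<open>bell_zeta\<close>.\<close>
    have "{y \<in> bell_neg_zeros (Suc n). z m < y} = z ` {1..<m}"
    proof (intro equalityI subsetI)
      fix y assume y: "y \<in> {y \<in> bell_neg_zeros (Suc n). z m < y}"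
      show "y \<in> z ` {1..<m}"
      proof (rule ccontr)
        assume "y \<notin> z ` {1..<m}"
        moreover have "{1..m} = insert m {1..<m}" using m by auto
        ultimately have "y \<notin> z ` {1..m}" using y by auto
        moreover have "0 \<notin> z ` {1..m}" using neg by force
        moreover have "y < 0" using y by (simp add: bell_neg_zeros_def)
        \<comment> \<open>An extra zero \<open>y\<close> would make \<open>m + 2\<close> zeros on
          \<open>?I\<close>, one more than a derivative of order \<open>m + 1\<close> without zeros
          there allows.\<close>
        moreover define A where "A = insert 0 (insert y (z ` {1..m}))"
        ultimately have "finite A" "card A = Suc (Suc m)"
          using inj by (simp_all add: card_image)
        moreover have "A \<subseteq> ?I"
        proof
          fix x assume "x \<in> A"
          then consider "x = 0" | "x = y" | i where "i \<in> {1..m}" "x = z i"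
            by (auto simp: A_def)
          then show "x \<in> ?I"
          proof cases
            case 1
            then show ?thesis using zm(1) neg[of m] m by simp
          next
            case 2
            then show ?thesis using zm(1) y \<open>y < 0\<close> by simp
          next
            case 3
            then show ?thesis using zm(1) ge[of i] neg[of i] by simp
          qed
        qed
        moreover have "\<forall>x\<in>A. poly ?p x = 0"
          using y Z by (auto simp: A_def bell_neg_zeros_def poly_bell_poly_0)
        ultimately have "\<exists>x\<in>?I. poly ((pderiv ^^ Suc m) ?p) x = 0"
          by (intro poly_zeros_higher_pderiv[of A]) simp_all
        then show False using elim(2) by blast
      qed
    next
      fix y assume "y \<in> z ` {1..<m}"
      then show "y \<in> {y \<in> bell_neg_zeros (Suc n). z m < y}"
        using Z mono[of _ m] by auto
    qed
    moreover have "inj_on z {1..<m}"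
      by (rule inj_on_subset[OF inj]) auto
    ultimately have "card {y \<in> bell_neg_zeros (Suc n). z m < y} = m - 1"
      by (simp add: card_image)
    moreover have "finite (bell_neg_zeros (Suc n))"
      unfolding bell_neg_zeros_def
      by (rule finite_subset[OF _ poly_roots_finite[OF bell_poly_nonzero[of "Suc n"]]]) auto
    ultimately have "bell_zeta m (Suc n) = z m"
      unfolding bell_zeta_def using Z[of m] m by (intro nth_rev_sorted_list_of_set) auto
    then show ?case using zm by (simp add: r_def)
  qed
qed

theorem theorem1p1:
  fixes m :: nat
  assumes "m \<ge> 1"
  shows "(\<lambda>n. bell_zeta m n / (- real m * (real m / (real m + 1)) ^ (n - 1))) \<longlonglongrightarrow> 1"
\<comment> \<open>Passing to \<open>Suc n\<close> turns the exponent \<open>n - 1\<close> into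
  \<open>n\<close> and leaves out the truncated subtraction at 0.\<close>
proof (rule LIMSEQ_imp_Suc, rule tendstoI)
  fix d :: real
  assume d: "d > 0"
  \<comment> \<open>The cap \<open>1 / 2\<close> is required for the windows; a window of half-width
    \<open>e\<close> around \<open>m\<close> gives relative error below \<open>e / m\<close>, at
    most \<open>d\<close> since \<open>m \<ge> 1\<close>.\<close>
  define e where "e = min d (1 / 2)"
  have e: "0 < e" "e \<le> 1 / 2" "e \<le> d" using d by (auto simp: e_def)
  show "\<forall>\<^sub>F n in sequentially.
      dist (bell_zeta m (Suc n) / (- real m * (real m / (real m + 1)) ^ (Suc n - 1))) 1 < d"
    using eventually_bell_zeta_in_window[OF assms e(1,2)]
  proof eventually_elim
    case (elim n)
    define w where "w = (real m / real (Suc m)) ^ n"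
    define b where "b = - bell_zeta m (Suc n) / w"
    have w: "w > 0" using assms by (simp add: w_def)
    have "- (real m + e) * w < bell_zeta m (Suc n)" "bell_zeta m (Suc n) < - (real m - e) * w"
      using elim by (simp_all only: w_def)
    then have "real m - e < b" "b < real m + e"
      using w by (simp_all add: b_def field_simps)
    then have "\<bar>b - real m\<bar> < e" by linarith
    also have "e \<le> d * real m"
      using mult_mono[of e d 1 "real m"] e d assms by simp
    finally have "\<bar>b - real m\<bar> / real m < d" using assms by (simp add: divide_less_eq)
    moreover have "\<bar>b / real m - 1\<bar> = \<bar>b - real m\<bar> / real m"
    proof -
      have "b / real m - 1 = (b - real m) / real m" using assms by (simp add: field_simps)
      then show ?thesis by (simp add: abs_divide)
    qed
    moreover have "bell_zeta m (Suc n) / (- real m * (real m / (real m + 1)) ^ (Suc n - 1)) = b / real m"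
      using w by (simp add: b_def w_def add.commute)
    ultimately show ?case by (simp only: dist_real_def)
  qed
qed

end
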